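(* Let $X=(X_1,\ldots,X_N)$ be a family of (not necessarily independent) random variables with $X_k$ taking values in a set $\Lambda_k$. Let $\Gamma\subseteq\prod_{j\in[N]}\Lambda_j$ be an event, and let $f:\prod_{j\in[N]}\Lambda_j\to\mathbb{R}$ be a function satisfying the following general Lipschitz condition: there are numbers $(c_k)_{k\in[N]}$ and $(d_k)_{k\in[N]}$ with $c_k\le d_k$ such that the following holds for every $k\in[N]$ and any two possible sequences of outcomes $a_1,\ldots,a_{k-1},a$ and $a_1,\ldots,a_{k-1},b$ of $X_1,\ldots,X_k$. Defining, for $z\in\{a,b\}$, $$\Sigma_z=\Bigl\{x=(a_1,\ldots,a_{k-1},z,x_{k+1},\ldots,x_N)\in\prod_{j\in[N]}\Lambda_j:\ \mathbb{P}(X=x)>0\Bigr\},$$ there is an injection $\rho_k=\rho_k(\Sigma_a,\Sigma_b):\Sigma_a\to\Sigma_b$ such that for all $x\in\Sigma_a$ we have $$|f(x)-f(\rho_k(x))|\le\begin{cases}c_k&\text{if }x\in\Gamma,\\ d_k&\text{otherwise,}\end{cases}$$ and $$\mathbb{P}(X=x\mid X\in\Sigma_a)\le\mathbb{P}(X=\rho_k(x)\mid X\in\Sigma_b).$$ Then for any numbers $(\gamma_k)_{k\in[N]}$ with $\gamma_k\in(0,1]$ there is an event $\mathcal{B}=\mathcal{B}(\Gamma,(\gamma_k)_{k\in[N]})$ satisfying $$\mathbb{P}(\mathcal{B})\le\sum_{k\in[N]}\gamma_k^{-1}\cdot\mathbb{P}(X\notin\Gamma)\quad\text{and}\quad\neg\mathcal{B}\subseteq\Gamma,$$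 such that for $\mu=\mathbb{E}f(X)$, $e_k=\gamma_k(d_k-c_k)$ and any $t\ge0$ we have $$\mathbb{P}(f(X)\ge\mu+t\text{ and }\neg\mathcal{B})\le\exp\left(-\frac{t^2}{2\sum_{k\in[N]}(c_k+e_k)^2}\right).$$
   Context: $[N]=\{1,\ldots,N\}$. The random variables are discrete (their joint law is determined by the point probabilities $\mathbb{P}(X=x)$). A sequence of outcomes of $X_1,\ldots,X_k$ is possible if it occurs with positive probability. Events $\mathcal{B},\Gamma$ are identified with subsets of $\prod_{j\in[N]}\Lambda_j$; $\mathbb{P}(\mathcal{B})=\mathbb{P}(X\in\mathcal{B})$ and $\neg\mathcal{B}$ is the complement. The notation $\mathcal{B}=\mathcal{B}(\Gamma,(\gamma_k)_{k\in[N]})$ means that $\mathcal{B}$ depends only on $\Gamma$ and $(\gamma_k)$ (and the law of $X$), not on $f$ or $t$. *)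

theory Defs
  imports "HOL-Probability.Probability"
begin

text \<open>
  All \<open>\<Lambda> k\<close> live in one type \<open>'a\<close>, and a point of the product over \<open>{1..N}\<close> is an
  extensional function, i.e. an element of \<open>PiE {1..N} \<Lambda>\<close>.
\<close>

definition joint_rv :: "nat \<Rightarrow> (nat \<Rightarrow> 'w \<Rightarrow> 'a) \<Rightarrow> 'w \<Rightarrow> (nat \<Rightarrow> 'a)" where
  "joint_rv N X \<omega> = (\<lambda>k\<in>{1..N}. X k \<omega>)"

text \<open>
  Discreteness: the joint law is defined on all subsets of the product and is carried by a
  countable set, hence is determined by its point probabilities. Measurability of the single
  \<open>X k\<close> into \<open>count_space (\<Lambda> k)\<close> follows. It alone would not suffice when the \<open>\<Lambda> k\<close> are
  uncountable, as the event that the joint variable lies in an arbitrary subset of the product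
  need not then be measurable.
\<close>

definition discrete_family ::
    "'w measure \<Rightarrow> nat \<Rightarrow> (nat \<Rightarrow> 'a set) \<Rightarrow> (nat \<Rightarrow> 'w \<Rightarrow> 'a) \<Rightarrow> bool" where
  "discrete_family M N \<Lambda> X \<longleftrightarrow>
     joint_rv N X \<in> measurable M (count_space (PiE {1..N} \<Lambda>)) \<and>
     (\<exists>S. countable S \<and> (AE \<omega> in M. joint_rv N X \<omega> \<in> S))"

text \<open>Only the entries \<open>a 1, \<dots>, a k\<close> of \<open>a\<close> matter.\<close>

definition possible_outcomes ::
    "'w measure \<Rightarrow> (nat \<Rightarrow> 'w \<Rightarrow> 'a) \<Rightarrow> nat \<Rightarrow> (nat \<Rightarrow> 'a) \<Rightarrow> bool" where
  "possible_outcomes M X k a \<longleftrightarrow> \<P>(\<omega> in M. \<forall>j\<in>{1..k}. X j \<omega> = a j) > 0"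

definition extensions ::
    "'w measure \<Rightarrow> nat \<Rightarrow> (nat \<Rightarrow> 'a set) \<Rightarrow> (nat \<Rightarrow> 'w \<Rightarrow> 'a) \<Rightarrow> nat \<Rightarrow> (nat \<Rightarrow> 'a) \<Rightarrow> 'a
      \<Rightarrow> (nat \<Rightarrow> 'a) set" where
  "extensions M N \<Lambda> X k a z =
     {x \<in> PiE {1..N} \<Lambda>. (\<forall>j\<in>{1..<k}. x j = a j) \<and> x k = z \<and>
        \<P>(\<omega> in M. joint_rv N X \<omega> = x) > 0}"

definition general_lipschitz ::
    "'w measure \<Rightarrow> nat \<Rightarrow> (nat \<Rightarrow> 'a set) \<Rightarrow> (nat \<Rightarrow> 'w \<Rightarrow> 'a) \<Rightarrow> (nat \<Rightarrow> 'a) set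
      \<Rightarrow> ((nat \<Rightarrow> 'a) \<Rightarrow> real) \<Rightarrow> (nat \<Rightarrow> real) \<Rightarrow> (nat \<Rightarrow> real) \<Rightarrow> bool" where
  "general_lipschitz M N \<Lambda> X \<Gamma> f c d \<longleftrightarrow>
     (\<forall>k\<in>{1..N}. c k \<le> d k) \<and>
     (\<forall>k\<in>{1..N}. \<forall>a y z.
        possible_outcomes M X k (a(k := y)) \<and> possible_outcomes M X k (a(k := z)) \<longrightarrow>
        (let \<Sigma>y = extensions M N \<Lambda> X k a y; \<Sigma>z = extensions M N \<Lambda> X k a z in
         \<exists>\<rho>. \<rho> \<in> \<Sigma>y \<rightarrow> \<Sigma>z \<and> inj_on \<rho> \<Sigma>y \<and>
           (\<forall>x\<in>\<Sigma>y.
              \<bar>f x - f (\<rho> x)\<bar> \<le> (if x \<in> \<Gamma> then c k else d k) \<and>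
              \<P>(\<omega> in M. joint_rv N X \<omega> = x \<bar> joint_rv N X \<omega> \<in> \<Sigma>y)
                \<le> \<P>(\<omega> in M. joint_rv N X \<omega> = \<rho> x \<bar> joint_rv N X \<omega> \<in> \<Sigma>z))))"

text \<open>
  \<open>exp (- t\<^sup>2 / (2 * v))\<close> for \<open>t \<ge> 0\<close>, with its limit value \<open>0\<close> at \<open>v = 0 < t\<close>, where division
  by zero would turn the bound into the trivial \<open>exp 0 = 1\<close>.
\<close>

definition gaussian_tail :: "real \<Rightarrow> real \<Rightarrow> real" where
  "gaussian_tail t v = (if v = 0 \<and> 0 < t then 0 else exp (- t\<^sup>2 / (2 * v)))"

end

theory Submission
  imports Defs
begin

text \<open>
  The injections \<open>\<rho>\<^sub>k\<close> transport one conditional law onto the other: they increase point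
  probabilities, and both laws have total mass 1. Hence the conditional expectations of \<open>f\<close> given
  two values of the \<open>k\<close>-th coordinate differ by at most \<open>c\<^sub>k + (d\<^sub>k - c\<^sub>k) q\<close>, where \<open>q\<close> is the
  conditional probability of \<open>- \<Gamma>\<close> given either value. The bad event consists of \<open>- \<Gamma>\<close> and the
  outcomes for which, at some stage \<open>k\<close>, the conditional probability of \<open>- \<Gamma>\<close> given the first
  \<open>k - 1\<close> coordinates is at least \<open>\<gamma>\<^sub>k\<close>. Markov's inequality bounds its probability. As this
  condition is predictable, the increments of the Doob martingale of \<open>f\<close> off the bad event lie in
  intervals of length \<open>2 (c\<^sub>k + e\<^sub>k)\<close>, and Hoeffding's lemma and the Chernoff bound apply as in the
  Azuma--Hoeffding inequality.
\<close>

section \<open>Bounded integrands and comparison of discrete laws\<close>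

lemma integral_bind_pmf_bounded:
  fixes f :: "'b \<Rightarrow> real"
  assumes "\<And>x. \<bar>f x\<bar> \<le> L"
  shows "measure_pmf.expectation (bind_pmf p h) f
       = measure_pmf.expectation p (\<lambda>x. measure_pmf.expectation (h x) f)"
  unfolding measure_pmf_bind
  by (rule integral_bind[where K = "count_space UNIV" and B = L and B' = 1])
     (use assms in \<open>auto simp: measure_pmf.finite_measure_axioms
        measure_pmf.emeasure_space_1 intro: measure_pmf_in_subprob_algebra\<close>)

lemma integrable_measure_pmf_bounded:
  fixes f :: "'b \<Rightarrow> real"
  assumes "\<And>x. x \<in> set_pmf p \<Longrightarrow> \<bar>f x\<bar> \<le> L"
  shows "integrable (measure_pmf p) f"
  by (rule measure_pmf.integrable_const_bound[where B = L]) (auto simp: AE_measure_pmf_iff assms)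

text \<open>Both masses sum to 1, so a strict inequality at one point would force a reverse one
  elsewhere. This is how the one-sided inequality for the injections becomes an equality of
  laws.\<close>

lemma pmf_eq_if_pmf_le:
  assumes "\<And>x. pmf p x \<le> pmf q x"
  shows "p = q"
  using pmf_neq_exists_less[of q p] assms by (metis not_le)

section \<open>Conditional laws given the first coordinates\<close>

text \<open>For fixed \<open>k\<close> these are the classes of an equivalence relation: the atoms
  of the sigma-algebra generated by the first \<open>k\<close> coordinates.\<close>

definition cyl :: "nat \<Rightarrow> (nat \<Rightarrow> 'a) \<Rightarrow> (nat \<Rightarrow> 'a) set" where
  "cyl k x = {y. \<forall>j\<in>{1..k}. y j = x j}"

definition prefix_pmf :: "(nat \<Rightarrow> 'a) pmf \<Rightarrow> nat \<Rightarrow> (nat \<Rightarrow> 'a) \<Rightarrow> (nat \<Rightarrow> 'a) pmf" where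
  "prefix_pmf p k x = cond_pmf p (cyl k x)"

lemma in_cyl_self [simp]: "x \<in> cyl k x"
  by (simp add: cyl_def)

lemma cyl_0 [simp]: "cyl 0 x = UNIV"
  by (simp add: cyl_def)

lemma cyl_cong: "y \<in> cyl k x \<Longrightarrow> cyl k y = cyl k x"
  by (auto simp: cyl_def)

lemma cyl_antimono: "k \<le> l \<Longrightarrow> cyl l x \<subseteq> cyl k x"
  by (auto simp: cyl_def)

lemma in_cyl_Suc_iff: "y \<in> cyl (Suc k) x \<longleftrightarrow> y \<in> cyl k x \<and> y (Suc k) = x (Suc k)"
  by (auto simp: cyl_def atLeastAtMostSuc_conv)

lemma set_prefix_pmf [simp]:
  "x \<in> set_pmf p \<Longrightarrow> set_pmf (prefix_pmf p k x) = set_pmf p \<inter> cyl k x"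
  unfolding prefix_pmf_def by (rule set_cond_pmf) (use in_cyl_self in blast)

lemma pmf_prefix_pmf:
  "x \<in> set_pmf p \<Longrightarrow> pmf (prefix_pmf p k x) w =
     (if w \<in> cyl k x then pmf p w / measure_pmf.prob p (cyl k x) else 0)"
  unfolding prefix_pmf_def by (rule pmf_cond) (use in_cyl_self in blast)

lemma prefix_pmf_0 [simp]: "prefix_pmf p 0 x = p"
proof -
  have "set_pmf p \<inter> UNIV \<noteq> {}"
    by (simp add: set_pmf_not_empty)
  from pmf_cond[OF this] show ?thesis
    by (intro pmf_eqI) (simp add: prefix_pmf_def)
qed

lemma prefix_pmf_cong: "y \<in> cyl k x \<Longrightarrow> prefix_pmf p k y = prefix_pmf p k x"
  by (simp add: prefix_pmf_def cyl_cong)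

text \<open>The finer cylinder lies inside the coarser one, so the normalising constant of the first
  conditioning cancels.\<close>

lemma cond_prefix_pmf:
  assumes "x \<in> set_pmf p" and "y \<in> set_pmf p \<inter> cyl k x" and "k \<le> l"
  shows "cond_pmf (prefix_pmf p k x) (cyl l y) = prefix_pmf p l y"
proof (rule pmf_eqI)
  fix w
  have sub: "cyl l y \<subseteq> cyl k x"
    using assms cyl_antimono[of k l y] cyl_cong[of y k x] by auto
  have ne: "set_pmf p \<inter> cyl k x \<noteq> {}"
    using assms by blast
  have ne': "set_pmf (prefix_pmf p k x) \<inter> cyl l y \<noteq> {}"
    using assms in_cyl_self[of y l] by auto
  have pos: "measure_pmf.prob p (cyl k x) > 0"
    using assms by (intro measure_pmf_posI[of x]) auto
  have "measure (prefix_pmf p k x) (cyl l y)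
      = measure_pmf.prob p (cyl l y) / measure_pmf.prob p (cyl k x)"
    unfolding prefix_pmf_def
    using sub ne pos
    by (subst cond_pmf.rep_eq[OF ne], subst measure_uniform_measure)
       (auto simp: measure_pmf.emeasure_eq_measure Int_absorb1)
  then show "pmf (cond_pmf (prefix_pmf p k x) (cyl l y)) w = pmf (prefix_pmf p l y) w"
    using assms sub pos by (auto simp: pmf_cond[OF ne'] pmf_prefix_pmf)
qed

text \<open>Law of total probability: the cylinders of level \<open>l\<close> partition the support,
  so resampling within the cylinder of a random point does not change the law.\<close>

lemma prefix_pmf_tower:
  assumes x: "x \<in> set_pmf p" and "k \<le> l"
  shows "bind_pmf (prefix_pmf p k x) (prefix_pmf p l) = prefix_pmf p k x"
proof -
  let ?q = "prefix_pmf p k x"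
  \<comment> \<open>\<open>bind_cond_pmf_cancel\<close> is phrased for a relation. Lying in the same
    cylinder is symmetric, so both of its sections are cylinders.\<close>
  have R: "{y'. y' \<in> cyl l y} = cyl l y" "{y'. y \<in> cyl l y'} = cyl l y" for y :: "nat \<Rightarrow> 'a"
    by (auto simp: cyl_def)
  have "bind_pmf ?q (prefix_pmf p l) = bind_pmf ?q (\<lambda>y. cond_pmf ?q {z. z \<in> cyl l y})"
    using assms by (intro bind_pmf_cong) (auto simp: cond_prefix_pmf)
  also have "\<dots> = ?q"
  proof (rule bind_cond_pmf_cancel)
    fix y z assume "y \<in> set_pmf ?q" "z \<in> set_pmf ?q" "z \<in> cyl l y"
    then show "measure ?q {z. z \<in> cyl l y} = measure ?q {y. z \<in> cyl l y}"
      by (simp add: R cyl_cong)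
  qed (use in_cyl_self in blast)+
  finally show ?thesis .
qed

lemma expectation_prefix_tower:
  fixes f :: "(nat \<Rightarrow> 'a) \<Rightarrow> real"
  assumes "x \<in> set_pmf p" and "k \<le> l" and "\<And>x. \<bar>f x\<bar> \<le> L"
  shows "measure_pmf.expectation (prefix_pmf p k x)
           (\<lambda>y. measure_pmf.expectation (prefix_pmf p l y) f)
       = measure_pmf.expectation (prefix_pmf p k x) f"
  using integral_bind_pmf_bounded[OF assms(3), of "prefix_pmf p k x" "prefix_pmf p l"]
  by (simp add: prefix_pmf_tower assms)

section \<open>Transport between conditional laws\<close>

text \<open>The Lipschitz condition expressed through the law \<open>p\<close> alone, with equality
  of laws in place of injectivity and the inequality of point probabilities. The index is shifted: a
  common prefix of length \<open>k\<close> belongs to stage \<open>Suc k\<close>.\<close>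

definition lipschitz_coupling ::
    "(nat \<Rightarrow> 'a) pmf \<Rightarrow> nat \<Rightarrow> (nat \<Rightarrow> 'a) set \<Rightarrow> ((nat \<Rightarrow> 'a) \<Rightarrow> real)
      \<Rightarrow> (nat \<Rightarrow> real) \<Rightarrow> (nat \<Rightarrow> real) \<Rightarrow> bool" where
  "lipschitz_coupling p N \<Gamma> f c d \<longleftrightarrow>
     (\<forall>k<N. \<forall>x\<in>set_pmf p. \<forall>y\<in>set_pmf p \<inter> cyl k x.
        \<exists>\<rho>. map_pmf \<rho> (prefix_pmf p (Suc k) x) = prefix_pmf p (Suc k) y \<and>
          (\<forall>w\<in>set_pmf p \<inter> cyl (Suc k) x.
             \<bar>f w - f (\<rho> w)\<bar> \<le> (if w \<in> \<Gamma> then c (Suc k) else d (Suc k))))"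

lemma lipschitz_coupling_range:
  assumes "lipschitz_coupling p N \<Gamma> f c d" and "x \<in> set_pmf p" and "y \<in> set_pmf p \<inter> cyl k x"
    and \<rho>: "map_pmf \<rho> (prefix_pmf p (Suc k) x) = prefix_pmf p (Suc k) y"
    and "w \<in> set_pmf p \<inter> cyl (Suc k) x"
  shows "\<rho> w \<in> set_pmf p \<inter> cyl (Suc k) y"
proof -
  have "\<rho> w \<in> set_pmf (prefix_pmf p (Suc k) y)"
    unfolding \<rho>[symmetric] using assms(2,5) by simp
  then show ?thesis
    using assms(3) by simp
qed

text \<open>Any outcome is carried to any other by changing one coordinate after the other.\<close>

lemma lipschitz_coupling_oscillation:
  assumes coup: "lipschitz_coupling p N \<Gamma> f c d" and le: "\<And>k. k \<in> {1..N} \<Longrightarrow> c k \<le> d k"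
    and det: "\<And>x y. x \<in> set_pmf p \<Longrightarrow> y \<in> set_pmf p \<inter> cyl N x \<Longrightarrow> y = x"
    and "k \<le> N" "x \<in> set_pmf p" "y \<in> set_pmf p \<inter> cyl k x"
  shows "\<bar>f x - f y\<bar> \<le> (\<Sum>j\<in>{Suc k..N}. d j)"
  using \<open>k \<le> N\<close> \<open>x \<in> set_pmf p\<close> \<open>y \<in> set_pmf p \<inter> cyl k x\<close>
proof (induction arbitrary: x y rule: inc_induct)
  case base
  then show ?case
    using det[of x y] by simp
next
  case (step k)
  obtain \<rho> where \<rho>: "map_pmf \<rho> (prefix_pmf p (Suc k) x) = prefix_pmf p (Suc k) y"
    and b: "\<And>w. w \<in> set_pmf p \<inter> cyl (Suc k) x \<Longrightarrow>
             \<bar>f w - f (\<rho> w)\<bar> \<le> (if w \<in> \<Gamma> then c (Suc k) else d (Suc k))"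
    using coup step.prems step.hyps unfolding lipschitz_coupling_def by meson
  \<comment> \<open>The point \<open>\<rho> x\<close> shares one more coordinate with
    \<open>y\<close> than \<open>x\<close> does, so the induction hypothesis covers the rest of the
    way.\<close>
  have "\<rho> x \<in> set_pmf p \<inter> cyl (Suc k) y"
    using lipschitz_coupling_range[OF coup step.prems \<rho>] step.prems by simp
  then have "\<bar>f (\<rho> x) - f y\<bar> \<le> (\<Sum>j\<in>{Suc (Suc k)..N}. d j)"
    using step.IH[of y "\<rho> x"] step.prems by (simp add: abs_minus_commute)
  moreover have "\<bar>f x - f (\<rho> x)\<bar> \<le> d (Suc k)"
    using b[of x] le[of "Suc k"] step by (auto split: if_splits)
  moreover have "(\<Sum>j\<in>{Suc k..N}. d j) = d (Suc k) + (\<Sum>j\<in>{Suc (Suc k)..N}. d j)"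
    using step.hyps by (simp add: sum.atLeast_Suc_atMost)
  ultimately show ?case by linarith
qed

text \<open>The transport maps send support to support, so values elsewhere are irrelevant. This
  permits replacing \<open>f\<close> by a bounded function.\<close>

lemma lipschitz_coupling_cong:
  assumes "lipschitz_coupling p N \<Gamma> f c d" and "\<And>x. x \<in> set_pmf p \<Longrightarrow> f x = g x"
  shows "lipschitz_coupling p N \<Gamma> g c d"
  unfolding lipschitz_coupling_def
proof (intro allI impI ballI)
  fix k x y assume *: "k < N" "x \<in> set_pmf p" "y \<in> set_pmf p \<inter> cyl k x"
  then obtain \<rho> where \<rho>: "map_pmf \<rho> (prefix_pmf p (Suc k) x) = prefix_pmf p (Suc k) y"
    and b: "\<And>w. w \<in> set_pmf p \<inter> cyl (Suc k) x \<Longrightarrow>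
             \<bar>f w - f (\<rho> w)\<bar> \<le> (if w \<in> \<Gamma> then c (Suc k) else d (Suc k))"
    using assms(1) unfolding lipschitz_coupling_def by meson
  then show "\<exists>\<rho>. map_pmf \<rho> (prefix_pmf p (Suc k) x) = prefix_pmf p (Suc k) y \<and>
          (\<forall>w\<in>set_pmf p \<inter> cyl (Suc k) x.
             \<bar>g w - g (\<rho> w)\<bar> \<le> (if w \<in> \<Gamma> then c (Suc k) else d (Suc k)))"
    using lipschitz_coupling_range[OF assms(1) *(2,3) \<rho>] assms(2)
    by (intro exI[of _ \<rho>]) force
qed

section \<open>The bad event and its probability\<close>

definition atyp_prob :: "(nat \<Rightarrow> 'a) pmf \<Rightarrow> (nat \<Rightarrow> 'a) set \<Rightarrow> nat \<Rightarrow> (nat \<Rightarrow> 'a) \<Rightarrow> real" where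
  "atyp_prob p \<Gamma> k x = measure_pmf.prob (prefix_pmf p k x) (- \<Gamma>)"

text \<open>The test for stage \<open>Suc k\<close> looks at the first \<open>k\<close> coordinates
  only, which makes it predictable. Neither \<open>f\<close> nor \<open>t\<close> enters, so one
  event serves all of them.\<close>

definition bad_event ::
    "(nat \<Rightarrow> 'a) pmf \<Rightarrow> nat \<Rightarrow> (nat \<Rightarrow> 'a) set \<Rightarrow> (nat \<Rightarrow> real) \<Rightarrow> (nat \<Rightarrow> 'a) set" where
  "bad_event p N \<Gamma> \<gamma> = {x. x \<notin> \<Gamma> \<or> (\<exists>k<N. \<gamma> (Suc k) \<le> atyp_prob p \<Gamma> k x)}"

lemma atyp_prob_nonneg [simp]: "0 \<le> atyp_prob p \<Gamma> k x"
  by (simp add: atyp_prob_def)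

text \<open>Martingale property of the conditional probabilities of \<open>- \<Gamma>\<close>: the
  tower property for an indicator.\<close>

lemma atyp_prob_expectation:
  assumes "x \<in> set_pmf p" and "k \<le> l"
  shows "measure_pmf.expectation (prefix_pmf p k x) (atyp_prob p \<Gamma> l) = atyp_prob p \<Gamma> k x"
  using expectation_prefix_tower[OF assms, of "indicat_real (- \<Gamma>)" 1]
  by (simp add: atyp_prob_def[abs_def])

text \<open>Markov's inequality; by the martingale property from level 0, the mean at every level is
  the unconditional probability of \<open>- \<Gamma>\<close>.\<close>

lemma prob_atyp_prob_ge:
  assumes "0 < g"
  shows "measure_pmf.prob p {x. g \<le> atyp_prob p \<Gamma> k x} \<le> inverse g * measure_pmf.prob p (- \<Gamma>)"
proof -
  obtain x where x: "x \<in> set_pmf p"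
    using set_pmf_not_empty by fast
  have "integrable (measure_pmf p) (atyp_prob p \<Gamma> k)"
    by (rule integrable_measure_pmf_bounded[where L = 1]) (simp add: atyp_prob_def)
  then have "measure_pmf.prob p {x\<in>space p. g \<le> atyp_prob p \<Gamma> k x}
      \<le> measure_pmf.expectation p (atyp_prob p \<Gamma> k) / g"
    using assms by (intro integral_Markov_inequality_measure[where A = "{}"])
      simp_all
  also have "measure_pmf.expectation p (atyp_prob p \<Gamma> k) = measure_pmf.prob p (- \<Gamma>)"
    using atyp_prob_expectation[OF x, of 0 k \<Gamma>] by (simp add: atyp_prob_def)
  finally show ?thesis
    by (simp add: divide_inverse mult.commute)
qed

text \<open>
  The union bound has no summand to spare for \<open>- \<Gamma>\<close> itself: the first stage provides it, since
  there \<open>atyp_prob\<close> is constant.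
\<close>

lemma prob_bad_event_le:
  assumes "1 \<le> N" and \<gamma>: "\<And>k. k \<in> {1..N} \<Longrightarrow> 0 < \<gamma> k \<and> \<gamma> k \<le> 1"
  shows "measure_pmf.prob p (bad_event p N \<Gamma> \<gamma>)
       \<le> (\<Sum>k\<in>{1..N}. inverse (\<gamma> k) * measure_pmf.prob p (- \<Gamma>))"
proof -
  define A where "A k = {x. \<gamma> (Suc k) \<le> atyp_prob p \<Gamma> k x} \<union> (if k = 0 then - \<Gamma> else {})" for k
  have "measure_pmf.prob p (A k) \<le> inverse (\<gamma> (Suc k)) * measure_pmf.prob p (- \<Gamma>)"
    if "k < N" for k
  \<comment> \<open>At level 0 the test is deterministic. If it passes, only
    \<open>- \<Gamma>\<close> remains and \<open>\<gamma> 1 \<le> 1\<close> gives the bound; if it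
    fails, the level set is everything and absorbs \<open>- \<Gamma>\<close>.\<close>
  proof (cases "k = 0 \<and> \<not> \<gamma> 1 \<le> measure_pmf.prob p (- \<Gamma>)")
    case True
    then have "A k = - \<Gamma>"
      by (auto simp: A_def atyp_prob_def)
    moreover have "1 \<le> inverse (\<gamma> (Suc k))"
      using \<gamma>[of "Suc k"] that by (simp add: one_le_inverse)
    ultimately show ?thesis
      using mult_right_mono[of 1 "inverse (\<gamma> (Suc k))" "measure_pmf.prob p (- \<Gamma>)"] by simp
  next
    case False
    then have "A k = {x. \<gamma> (Suc k) \<le> atyp_prob p \<Gamma> k x}"
      by (auto simp: A_def atyp_prob_def)
    then show ?thesis
      using prob_atyp_prob_ge[of "\<gamma> (Suc k)"] \<gamma>[of "Suc k"] that by simp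
  qed
  then have "(\<Sum>k<N. measure_pmf.prob p (A k))
      \<le> (\<Sum>k<N. inverse (\<gamma> (Suc k)) * measure_pmf.prob p (- \<Gamma>))"
    by (intro sum_mono) auto
  moreover have "measure_pmf.prob p (bad_event p N \<Gamma> \<gamma>) \<le> measure_pmf.prob p (\<Union>k<N. A k)"
  proof (rule measure_pmf.finite_measure_mono)
    show "bad_event p N \<Gamma> \<gamma> \<subseteq> (\<Union>k<N. A k)"
    proof
      fix x assume "x \<in> bad_event p N \<Gamma> \<gamma>"
      then consider "x \<notin> \<Gamma>" | k where "k < N" "\<gamma> (Suc k) \<le> atyp_prob p \<Gamma> k x"
        by (auto simp: bad_event_def)
      then show "x \<in> (\<Union>k<N. A k)"
      proof cases
        case 1
        then have "x \<in> A 0"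
          by (simp add: A_def)
        then show ?thesis
          using \<open>1 \<le> N\<close> by auto
      next
        case 2
        then have "x \<in> A k"
          by (simp add: A_def)
        then show ?thesis
          using \<open>k < N\<close> by blast
      qed
    qed
  qed simp
  moreover have "measure_pmf.prob p (\<Union>k<N. A k) \<le> (\<Sum>k<N. measure_pmf.prob p (A k))"
    by (intro measure_pmf.finite_measure_subadditive_finite) auto
  moreover have "(\<Sum>k<N. inverse (\<gamma> (Suc k)) * measure_pmf.prob p (- \<Gamma>))
      = (\<Sum>k\<in>{1..N}. inverse (\<gamma> k) * measure_pmf.prob p (- \<Gamma>))"
    by (intro sum.reindex_bij_witness[of _ "\<lambda>k. k - 1" Suc]) auto
  ultimately show ?thesis by linarith
qed

section \<open>Increments of the Doob martingale\<close>

text \<open>Transporting by \<rho> writes both expectations under the single law at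
  \<open>x\<close>. The integrand \<open>f w - f (\<rho> w)\<close> then costs \<open>c\<close> on
  \<Gamma> and the surplus \<open>d - c\<close> only off \<Gamma>, measured at the source
  \<open>x\<close>.\<close>

lemma expectation_prefix_diff_le:
  assumes "lipschitz_coupling p N \<Gamma> f c d" and bd: "\<And>x. \<bar>f x\<bar> \<le> L"
    and "k < N" and x: "x \<in> set_pmf p" and y: "y \<in> set_pmf p \<inter> cyl k x"
  shows "\<bar>measure_pmf.expectation (prefix_pmf p (Suc k) x) f
          - measure_pmf.expectation (prefix_pmf p (Suc k) y) f\<bar>
       \<le> c (Suc k) + (d (Suc k) - c (Suc k)) * atyp_prob p \<Gamma> (Suc k) x"
proof -
  let ?q = "prefix_pmf p (Suc k) x" and ?c = "c (Suc k)" and ?d = "d (Suc k)"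
  obtain \<rho> where \<rho>: "map_pmf \<rho> ?q = prefix_pmf p (Suc k) y"
    and b: "\<And>w. w \<in> set_pmf p \<inter> cyl (Suc k) x \<Longrightarrow>
             \<bar>f w - f (\<rho> w)\<bar> \<le> (if w \<in> \<Gamma> then ?c else ?d)"
    using assms unfolding lipschitz_coupling_def by meson
  have int: "integrable (measure_pmf ?q) h" if "\<And>x. \<bar>h x\<bar> \<le> B" for h :: "_ \<Rightarrow> real" and B
    using that by (rule integrable_measure_pmf_bounded)
  have int_f: "integrable (measure_pmf ?q) f" "integrable (measure_pmf ?q) (\<lambda>w. f (\<rho> w))"
    using bd by (auto intro: int)
  have int_ind: "integrable (measure_pmf ?q) (indicat_real (- \<Gamma>))"
    by (rule int[of _ 1]) (auto simp: indicator_def)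
  have "\<bar>measure_pmf.expectation ?q f - measure_pmf.expectation (prefix_pmf p (Suc k) y) f\<bar>
      = \<bar>measure_pmf.expectation ?q (\<lambda>w. f w - f (\<rho> w))\<bar>"
    unfolding \<rho>[symmetric] using int_f by simp
  also have "\<dots> \<le> measure_pmf.expectation ?q (\<lambda>w. \<bar>f w - f (\<rho> w)\<bar>)"
    by (rule integral_abs_bound)
  also have "\<dots> \<le> measure_pmf.expectation ?q (\<lambda>w. ?c + (?d - ?c) * indicator (- \<Gamma>) w)"
  proof (rule integral_mono_AE)
    show "AE w in ?q. \<bar>f w - f (\<rho> w)\<bar> \<le> ?c + (?d - ?c) * indicator (- \<Gamma>) w"
      unfolding AE_measure_pmf_iff
    proof
      fix w assume "w \<in> set_pmf ?q"
      then show "\<bar>f w - f (\<rho> w)\<bar> \<le> ?c + (?d - ?c) * indicator (- \<Gamma>) w"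
        using b[of w] x by (cases "w \<in> \<Gamma>") auto
    qed
  qed (use int_f int_ind in simp_all)
  also have "\<dots> = ?c + (?d - ?c) * atyp_prob p \<Gamma> (Suc k) x"
    using int_ind by (simp add: atyp_prob_def)
  finally show ?thesis .
qed

text \<open>
  If the atypical probability is small given the first \<open>k\<close> coordinates, it is small for at least
  one value of the next coordinate. All other conditional expectations are close to that one.
\<close>

lemma expectation_prefix_range:
  assumes coup: "lipschitz_coupling p N \<Gamma> f c d" and bd: "\<And>x. \<bar>f x\<bar> \<le> L"
    and le: "c (Suc k) \<le> d (Suc k)"
    and "k < N" and x: "x \<in> set_pmf p" and typical: "atyp_prob p \<Gamma> k x < g"
  obtains m where "\<And>y. y \<in> set_pmf p \<inter> cyl k x \<Longrightarrow>
    \<bar>measure_pmf.expectation (prefix_pmf p (Suc k) y) f - m\<bar>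
      \<le> c (Suc k) + g * (d (Suc k) - c (Suc k))"
proof -
  \<comment> \<open>Otherwise the average of the next-level probabilities would be at least
    \<open>g\<close>, while by the martingale property it is the current one, which is below
    \<open>g\<close>.\<close>
  have "\<exists>a\<in>set_pmf p \<inter> cyl k x. atyp_prob p \<Gamma> (Suc k) a \<le> g"
  proof (rule ccontr)
    assume "\<not> ?thesis"
    then have "AE a in prefix_pmf p k x. g \<le> atyp_prob p \<Gamma> (Suc k) a"
      using x by (force simp: AE_measure_pmf_iff not_le)
    then have "g \<le> measure_pmf.expectation (prefix_pmf p k x) (atyp_prob p \<Gamma> (Suc k))"
      by (intro measure_pmf.integral_ge_const integrable_measure_pmf_bounded[where L = 1])
         (auto simp: atyp_prob_def)
    then show False
      using typical atyp_prob_expectation[OF x, of k "Suc k" \<Gamma>] by simp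
  qed
  then obtain a where a: "a \<in> set_pmf p" "a \<in> cyl k x" "atyp_prob p \<Gamma> (Suc k) a \<le> g"
    by blast
  show ?thesis
  \<comment> \<open>The transport always starts at the favourable \<open>a\<close>, since the bound
    involves the atypical probability of the source only. That of \<open>y\<close> may be
    large.\<close>
  proof (rule that[of "measure_pmf.expectation (prefix_pmf p (Suc k) a) f"])
    fix y assume "y \<in> set_pmf p \<inter> cyl k x"
    then have "\<bar>measure_pmf.expectation (prefix_pmf p (Suc k) a) f
          - measure_pmf.expectation (prefix_pmf p (Suc k) y) f\<bar>
        \<le> c (Suc k) + (d (Suc k) - c (Suc k)) * atyp_prob p \<Gamma> (Suc k) a"
      using a by (intro expectation_prefix_diff_le[OF coup bd \<open>k < N\<close>]) (auto simp: cyl_cong)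
    also have "\<dots> \<le> c (Suc k) + g * (d (Suc k) - c (Suc k))"
      using mult_left_mono[OF a(3), of "d (Suc k) - c (Suc k)"] le by (simp add: mult.commute)
    finally show "\<bar>measure_pmf.expectation (prefix_pmf p (Suc k) y) f
          - measure_pmf.expectation (prefix_pmf p (Suc k) a) f\<bar>
        \<le> c (Suc k) + g * (d (Suc k) - c (Suc k))"
      by (simp add: abs_minus_commute)
  qed
qed

section \<open>Exponential moments and the Chernoff bound\<close>

text \<open>Backward induction on \<open>k\<close>, peeling off one martingale increment at a time.
  Keeping the indicator of the remaining tests inside the integral takes the place of stopping the
  martingale.\<close>

lemma nn_integral_exp_typical_le:
  fixes p :: "(nat \<Rightarrow> 'a) pmf" and f :: "(nat \<Rightarrow> 'a) \<Rightarrow> real"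
    and \<Gamma> :: "(nat \<Rightarrow> 'a) set" and \<gamma> :: "nat \<Rightarrow> real" and N :: nat
  defines "g \<equiv> \<lambda>k x. measure_pmf.expectation (prefix_pmf p k x) f"
    and "G \<equiv> \<lambda>k. {w. \<forall>j\<in>{k..<N}. atyp_prob p \<Gamma> j w < \<gamma> (Suc j)}"
  assumes coup: "lipschitz_coupling p N \<Gamma> f c d" and bd: "\<And>x. \<bar>f x\<bar> \<le> L"
    and le: "\<And>k. k \<in> {1..N} \<Longrightarrow> c k \<le> d k"
    and det: "\<And>x y. x \<in> set_pmf p \<Longrightarrow> y \<in> set_pmf p \<inter> cyl N x \<Longrightarrow> y = x"
    and "0 < l" and "k \<le> N" and "x \<in> set_pmf p"
  shows "(\<integral>\<^sup>+w. ennreal (exp (l * (f w - g k x))) * indicator (G k) w \<partial>prefix_pmf p k x)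
       \<le> ennreal (exp (l\<^sup>2 / 2 * (\<Sum>j\<in>{Suc k..N}. (c j + \<gamma> j * (d j - c j))\<^sup>2)))"
  using \<open>k \<le> N\<close> \<open>x \<in> set_pmf p\<close>
proof (induction arbitrary: x rule: inc_induct)
  case base
  then have "set_pmf (prefix_pmf p N x) \<subseteq> {x}"
    using det by auto
  then have "prefix_pmf p N x = return_pmf x"
    by (simp add: set_pmf_subset_singleton)
  then show ?case
    by (simp add: g_def G_def)
next
  case (step k)
  let ?q = "prefix_pmf p k x" and ?g = "\<lambda>y. g (Suc k) y"
  define C where "C j = c j + \<gamma> j * (d j - c j)" for j
  define S where "S = exp (l\<^sup>2 / 2 * (\<Sum>j\<in>{Suc (Suc k)..N}. (C j)\<^sup>2))"
  show ?case
  \<comment> \<open>The test at level \<open>k\<close> is constant on the cylinder of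
    \<open>x\<close>: if it fails, the indicator kills the whole integral; if it passes, the
    increment is controlled.\<close>
  proof (cases "atyp_prob p \<Gamma> k x < \<gamma> (Suc k)")
    case False
    have "w \<notin> G k" if "w \<in> cyl k x" for w
      using False step.hyps prefix_pmf_cong[OF that, of p]
      by (auto simp: G_def atyp_prob_def intro!: bexI[of _ k])
    then have "AE w in ?q. ennreal (exp (l * (f w - g k x))) * indicator (G k) w = 0"
      using step.prems by (auto simp: AE_measure_pmf_iff)
    then show ?thesis
      by (subst nn_integral_0_iff_AE[THEN iffD2]) auto
  next
    case True
    obtain m where m: "\<And>y. y \<in> set_pmf p \<inter> cyl k x \<Longrightarrow> \<bar>?g y - m\<bar> \<le> C (Suc k)"
      using expectation_prefix_range[OF coup bd _ _ step.prems True] le[of "Suc k"] step.hyps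
      unfolding g_def C_def by auto
    \<comment> \<open>The centre \<open>m\<close> need not be the mean, as Hoeffding's lemma uses
      only the length of the interval. Length \<open>2 * C (Suc k)\<close> produces the exponent
      \<open>l\<^sup>2 * (C (Suc k))\<^sup>2 / 2\<close>.\<close>
    interpret hoeffding: interval_bounded_random_variable ?q ?g "m - C (Suc k)" "m + C (Suc k)"
      using m step.prems
      by unfold_locales (fastforce simp: AE_measure_pmf_iff abs_le_iff)+
    have mean: "measure_pmf.expectation ?q ?g = g k x"
      unfolding g_def using step.prems bd by (intro expectation_prefix_tower) auto
    have "(\<integral>\<^sup>+w. ennreal (exp (l * (f w - g k x))) * indicator (G k) w \<partial>?q)
        = (\<integral>\<^sup>+y. \<integral>\<^sup>+w. ennreal (exp (l * (f w - g k x))) * indicator (G k) w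
            \<partial>prefix_pmf p (Suc k) y \<partial>?q)"
      by (subst nn_integral_bind_pmf[symmetric]) (simp add: prefix_pmf_tower step.prems)
    also have "\<dots> \<le> (\<integral>\<^sup>+y. ennreal (exp (l * (?g y - g k x))) * ennreal S \<partial>?q)"
    proof (rule nn_integral_mono_AE, unfold AE_measure_pmf_iff, rule ballI)
      fix y assume "y \<in> set_pmf ?q"
      then have y: "y \<in> set_pmf p" using step.prems by simp
      \<comment> \<open>The exponential splits at the next conditional expectation, and dropping the
        test at level \<open>k\<close> enlarges \<open>G k\<close> to
        \<open>G (Suc k)\<close>.\<close>
      have "(\<integral>\<^sup>+w. ennreal (exp (l * (f w - g k x))) * indicator (G k) w
            \<partial>prefix_pmf p (Suc k) y)
          \<le> (\<integral>\<^sup>+w. ennreal (exp (l * (?g y - g k x))) *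
              (ennreal (exp (l * (f w - ?g y))) * indicator (G (Suc k)) w)
            \<partial>prefix_pmf p (Suc k) y)"
        by (intro nn_integral_mono)
           (auto simp: G_def indicator_def algebra_simps simp flip: ennreal_mult exp_add)
      also have "\<dots> \<le> ennreal (exp (l * (?g y - g k x))) * ennreal S"
        using step.IH[OF y] unfolding S_def C_def
        by (subst nn_integral_cmult) (auto intro: mult_left_mono)
      finally show "(\<integral>\<^sup>+w. ennreal (exp (l * (f w - g k x))) * indicator (G k) w
            \<partial>prefix_pmf p (Suc k) y) \<le> ennreal (exp (l * (?g y - g k x))) * ennreal S" .
    qed
    also have "\<dots> = (\<integral>\<^sup>+y. ennreal (exp (l * (?g y - g k x))) \<partial>?q) * ennreal S"
      by (rule nn_integral_multc) simp
    also have "\<dots> \<le> ennreal (exp (l\<^sup>2 * (2 * C (Suc k))\<^sup>2 / 8)) * ennreal S"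
      using hoeffding.Hoeffdings_lemma_nn_integral[OF \<open>0 < l\<close>] unfolding mean
      by (intro mult_right_mono) (simp_all add: algebra_simps)
    also have "\<dots> = ennreal (exp (l\<^sup>2 * (2 * C (Suc k))\<^sup>2 / 8) * S)"
      by (simp add: ennreal_mult S_def)
    also have "exp (l\<^sup>2 * (2 * C (Suc k))\<^sup>2 / 8) * S = exp (l\<^sup>2 / 2 * (\<Sum>j\<in>{Suc k..N}. (C j)\<^sup>2))"
      using step.hyps unfolding S_def
      by (simp add: sum.atLeast_Suc_atMost power_mult_distrib algebra_simps flip: exp_add)
    finally show ?thesis
      unfolding C_def .
  qed
qed

text \<open>The exponent is minimal at \<open>l = t / v\<close>. For \<open>v = 0\<close> there is
  no minimum, and letting \<open>l\<close> grow forces \<open>P\<close> down to 0.\<close>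

lemma le_gaussian_tail:
  assumes exp_le: "\<And>l. 0 < l \<Longrightarrow> P \<le> exp (l\<^sup>2 / 2 * v - l * t)"
    and "P \<le> 1" and "0 \<le> v" and "0 \<le> t"
  shows "P \<le> gaussian_tail t v"
proof (cases "t = 0")
  case True
  then show ?thesis
    using \<open>P \<le> 1\<close> by (simp add: gaussian_tail_def)
next
  case t: False
  show ?thesis
  proof (cases "v = 0")
    case True
    have "P \<le> 0"
    proof (rule ccontr)
      assume "\<not> P \<le> 0"
      \<comment> \<open>The choice \<open>l = (1 - ln P) / t\<close> makes the bound
        \<open>exp (ln P - 1)\<close>, which is less than \<open>P\<close>.\<close>
      then have "0 < 1 - ln P"
        using \<open>P \<le> 1\<close> ln_le_zero_iff[of P] by linarith
      then have "P \<le> exp (- ((1 - ln P) / t * t))"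
        using exp_le[of "(1 - ln P) / t"] True t \<open>0 \<le> t\<close> by simp
      also have "\<dots> < exp (ln P)"
        using t by (simp del: exp_ln)
      finally show False
        using \<open>\<not> P \<le> 0\<close> by simp
    qed
    then show ?thesis
      using True t \<open>0 \<le> t\<close> by (simp add: gaussian_tail_def)
  next
    case False
    have "(t / v)\<^sup>2 / 2 * v - t / v * t = - t\<^sup>2 / (2 * v)"
      using False by (simp add: field_simps power2_eq_square)
    then show ?thesis
      using exp_le[of "t / v"] False t \<open>0 \<le> v\<close> \<open>0 \<le> t\<close> by (simp add: gaussian_tail_def)
  qed
qed

lemma prob_pmf_tail_le:
  fixes p :: "(nat \<Rightarrow> 'a) pmf" and f :: "(nat \<Rightarrow> 'a) \<Rightarrow> real"
  defines "\<mu> \<equiv> measure_pmf.expectation p f"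
  assumes coup: "lipschitz_coupling p N \<Gamma> f c d" and le: "\<And>k. k \<in> {1..N} \<Longrightarrow> c k \<le> d k"
    and det: "\<And>x y. x \<in> set_pmf p \<Longrightarrow> y \<in> set_pmf p \<inter> cyl N x \<Longrightarrow> y = x"
    and "0 \<le> t"
  shows "measure_pmf.prob p {x. f x \<ge> \<mu> + t \<and> x \<notin> bad_event p N \<Gamma> \<gamma>}
       \<le> gaussian_tail t (\<Sum>k\<in>{1..N}. (c k + \<gamma> k * (d k - c k))\<^sup>2)"
proof -
  obtain x0 where x0: "x0 \<in> set_pmf p"
    using set_pmf_not_empty by fast
  \<comment> \<open>The tower lemmas need a bound at every point, whereas \<open>f\<close> is
    arbitrary off the support.\<close>
  define F where "F x = (if x \<in> set_pmf p then f x else 0)" for x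
  define G where "G = {w. \<forall>j\<in>{0..<N}. atyp_prob p \<Gamma> j w < \<gamma> (Suc j)}"
  define v where "v = (\<Sum>k\<in>{1..N}. (c k + \<gamma> k * (d k - c k))\<^sup>2)"
  define A where "A = {x. f x \<ge> \<mu> + t \<and> x \<notin> bad_event p N \<Gamma> \<gamma>}"
  have coupF: "lipschitz_coupling p N \<Gamma> F c d"
    using coup by (rule lipschitz_coupling_cong) (simp add: F_def)
  \<comment> \<open>Boundedness comes from the coupling itself: every outcome shares the empty
    prefix with \<open>x0\<close>, so the oscillation bound applies with
    \<open>k = 0\<close>.\<close>
  have bdF: "\<bar>F x\<bar> \<le> \<bar>f x0\<bar> + \<bar>\<Sum>j\<in>{1..N}. d j\<bar>" for x
    using lipschitz_coupling_oscillation[OF coup le det, of 0 x0 x] x0 by (auto simp: F_def)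
  have \<mu>: "\<mu> = measure_pmf.expectation p F"
    unfolding \<mu>_def by (rule integral_cong_AE) (auto simp: AE_measure_pmf_iff F_def)
  have "measure_pmf.prob p A \<le> exp (l\<^sup>2 / 2 * v - l * t)" if "0 < l" for l
  proof -
    have "emeasure p A = (\<integral>\<^sup>+x. indicator A x \<partial>p)"
      by simp
    also have "\<dots> \<le> (\<integral>\<^sup>+x. ennreal (exp (- (l * t))) *
        (ennreal (exp (l * (F x - \<mu>))) * indicator G x) \<partial>p)"
    proof (rule nn_integral_mono_AE, unfold AE_measure_pmf_iff, rule ballI)
      fix x assume x: "x \<in> set_pmf p"
      show "indicator A x \<le> ennreal (exp (- (l * t))) *
        (ennreal (exp (l * (F x - \<mu>))) * indicator G x)"
      proof (cases "x \<in> A")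
        case True
        then have "x \<in> G" and "t \<le> F x - \<mu>"
          using x by (auto simp: A_def G_def F_def bad_event_def not_le)
        then have "1 \<le> exp (- (l * t)) * exp (l * (F x - \<mu>))"
          using \<open>0 < l\<close> by (simp flip: exp_add)
        then show ?thesis
          using True \<open>x \<in> G\<close> by (simp flip: ennreal_mult)
      qed simp
    qed
    also have "\<dots> = ennreal (exp (- (l * t))) *
        (\<integral>\<^sup>+x. ennreal (exp (l * (F x - \<mu>))) * indicator G x \<partial>p)"
      by (rule nn_integral_cmult) simp
    \<comment> \<open>At level 0 the conditional law is \<open>p\<close> and the conditional
      expectation is \<open>\<mu>\<close>.\<close>
    also have "\<dots> \<le> ennreal (exp (- (l * t))) * ennreal (exp (l\<^sup>2 / 2 * v))"
      using nn_integral_exp_typical_le[OF coupF bdF le det \<open>0 < l\<close> _ x0, of 0 \<gamma>]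
      unfolding \<mu> v_def G_def by (intro mult_left_mono) simp_all
    also have "\<dots> = ennreal (exp (l\<^sup>2 / 2 * v - l * t))"
      by (simp add: algebra_simps flip: ennreal_mult exp_add)
    finally show ?thesis
      by (simp add: measure_pmf.emeasure_eq_measure)
  qed
  then show ?thesis
    unfolding A_def[symmetric] v_def[symmetric] using \<open>0 \<le> t\<close>
    by (intro le_gaussian_tail) (auto simp: v_def intro: sum_nonneg)
qed

section \<open>From random variables to the discrete joint law\<close>

text \<open>A law carried by a countable set gives positive mass to almost every point, which is
  what \<open>Abs_pmf\<close> requires.\<close>

lemma discrete_family_pmf:
  assumes "prob_space M" and disc: "discrete_family M N \<Lambda> X"
  obtains p where "measure_pmf p = distr M (count_space UNIV) (joint_rv N X)"
    and "joint_rv N X \<in> measurable M (count_space UNIV)"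
    and "set_pmf p \<subseteq> PiE {1..N} \<Lambda>"
proof -
  interpret prob_space M by fact
  have J: "joint_rv N X \<in> measurable M (count_space (PiE {1..N} \<Lambda>))"
    using disc by (simp add: discrete_family_def)
  then have J': "joint_rv N X \<in> measurable M (count_space UNIV)"
    by (rule measurable_compose) simp
  let ?D = "distr M (count_space UNIV) (joint_rv N X)"
  interpret D: prob_space ?D
    by (rule prob_space_distr) (rule J')
  have "AE x in ?D. measure ?D {x} \<noteq> 0"
    using disc J' by (subst D.AE_support_countable) (auto simp: discrete_family_def AE_distr_iff)
  then have eq: "measure_pmf (Abs_pmf ?D) = ?D"
    by (intro Abs_pmf_inverse) (simp add: D.prob_space_axioms)
  have "set_pmf (Abs_pmf ?D) \<subseteq> PiE {1..N} \<Lambda>"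
  proof
    fix x assume "x \<in> set_pmf (Abs_pmf ?D)"
    then have "measure ?D {x} \<noteq> 0"
      by (simp add: set_pmf.rep_eq eq)
    then have "joint_rv N X -` {x} \<inter> space M \<noteq> {}"
      using J' by (auto simp: measure_distr)
    then show "x \<in> PiE {1..N} \<Lambda>"
      using measurable_space[OF J] by auto
  qed
  with eq J' show ?thesis
    by (rule that)
qed

text \<open>By injectivity the pushed-forward law gives \<open>\<rho> w\<close> exactly the mass of
  \<open>w\<close>. The hypothesis thus says that this law lies pointwise below the target law, and
  two probability laws so ordered coincide.\<close>

lemma lipschitz_coupling_if_general_lipschitz:
  assumes "prob_space M"
    and p: "measure_pmf p = distr M (count_space UNIV) (joint_rv N X)"
    and J: "joint_rv N X \<in> measurable M (count_space UNIV)"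
    and set_p: "set_pmf p \<subseteq> PiE {1..N} \<Lambda>"
    and lip: "general_lipschitz M N \<Lambda> X \<Gamma> f c d"
  shows "lipschitz_coupling p N \<Gamma> f c d"
  unfolding lipschitz_coupling_def
proof (intro allI impI ballI)
  interpret prob_space M by fact
  have prob: "\<P>(\<omega> in M. Q (joint_rv N X \<omega>)) = measure_pmf.prob p {x. Q x}" for Q
    unfolding p using J by (subst measure_distr) (auto intro!: arg_cong[where f = "measure M"])
  fix k x y assume "k < N" and x: "x \<in> set_pmf p" and y: "y \<in> set_pmf p \<inter> cyl k x"
  \<comment> \<open>Since \<open>z\<close> agrees with \<open>x\<close> on the first
    \<open>k\<close> coordinates, the set of extensions is the part of the support in the cylinder
    of \<open>z\<close>.\<close>
  have ext: "extensions M N \<Lambda> X (Suc k) x (z (Suc k)) = set_pmf p \<inter> cyl (Suc k) z"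
    if "z \<in> cyl k x" for z
  proof -
    have pos: "0 < \<P>(\<omega> in M. joint_rv N X \<omega> = w) \<longleftrightarrow> w \<in> set_pmf p" for w
      using prob[of "\<lambda>x. x = w"] by (simp add: pmf_positive_iff measure_pmf_single)
    have "(\<forall>j\<in>{1..<Suc k}. w j = x j) \<longleftrightarrow> w \<in> cyl k z" for w
      unfolding cyl_cong[OF that] by (auto simp: cyl_def)
    then show ?thesis
      using set_p unfolding extensions_def pos in_cyl_Suc_iff Int_def by blast
  qed
  have pos: "possible_outcomes M X (Suc k) (x(Suc k := z (Suc k)))"
    if "z \<in> set_pmf p" "z \<in> cyl k x" for z
  proof -
    have "(\<forall>j\<in>{1..Suc k}. X j \<omega> = (x(Suc k := z (Suc k))) j) \<longleftrightarrow> joint_rv N X \<omega> \<in> cyl (Suc k) z"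
      for \<omega>
      unfolding in_cyl_Suc_iff cyl_cong[OF that(2)] using \<open>k < N\<close>
      by (auto simp: cyl_def joint_rv_def atLeastAtMostSuc_conv)
    then show ?thesis
      unfolding possible_outcomes_def using prob[of "\<lambda>w. w \<in> cyl (Suc k) z"] that(1)
      by (simp add: measure_pmf_posI)
  qed
  have cond: "\<P>(\<omega> in M. joint_rv N X \<omega> = w \<bar> joint_rv N X \<omega> \<in> set_pmf p \<inter> cyl (Suc k) z)
      = pmf (prefix_pmf p (Suc k) z) w" if "z \<in> set_pmf p" "w \<in> set_pmf p \<inter> cyl (Suc k) z" for z w
  proof -
    have "{x. x = w \<and> x \<in> set_pmf p \<inter> cyl (Suc k) z} = {w}"
      using that by blast
    \<comment> \<open>Intersecting the cylinder with the support removes a null set only, so the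
      normalising constant agrees with that of \<open>prefix_pmf\<close>.\<close>
    moreover have "measure_pmf.prob p {x. x \<in> set_pmf p \<inter> cyl (Suc k) z}
        = measure_pmf.prob p (cyl (Suc k) z)"
      unfolding Collect_mem_eq by (subst Int_commute) (rule measure_Int_set_pmf)
    ultimately show ?thesis
      using that
      unfolding cond_prob_def prob[of "\<lambda>x. x = w \<and> x \<in> set_pmf p \<inter> cyl (Suc k) z"]
        prob[of "\<lambda>x. x \<in> set_pmf p \<inter> cyl (Suc k) z"]
      by (simp add: pmf_prefix_pmf measure_pmf_single)
  qed
  obtain \<rho> where \<rho>: "\<rho> \<in> set_pmf p \<inter> cyl (Suc k) x \<rightarrow> set_pmf p \<inter> cyl (Suc k) y"
      "inj_on \<rho> (set_pmf p \<inter> cyl (Suc k) x)"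
    and b: "\<And>w. w \<in> set_pmf p \<inter> cyl (Suc k) x \<Longrightarrow>
      \<bar>f w - f (\<rho> w)\<bar> \<le> (if w \<in> \<Gamma> then c (Suc k) else d (Suc k))"
    and le: "\<And>w. w \<in> set_pmf p \<inter> cyl (Suc k) x \<Longrightarrow>
      \<P>(\<omega> in M. joint_rv N X \<omega> = w \<bar> joint_rv N X \<omega> \<in> set_pmf p \<inter> cyl (Suc k) x)
      \<le> \<P>(\<omega> in M. joint_rv N X \<omega> = \<rho> w \<bar> joint_rv N X \<omega> \<in> set_pmf p \<inter> cyl (Suc k) y)"
  proof -
    have "Suc k \<in> {1..N}"
      using \<open>k < N\<close> by simp
    moreover have "possible_outcomes M X (Suc k) (x(Suc k := x (Suc k)))"
      using pos[of x] x by simp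
    moreover have "possible_outcomes M X (Suc k) (x(Suc k := y (Suc k)))"
      using pos[of y] y by simp
    moreover have ext_x: "extensions M N \<Lambda> X (Suc k) x (x (Suc k)) = set_pmf p \<inter> cyl (Suc k) x"
      and ext_y: "extensions M N \<Lambda> X (Suc k) x (y (Suc k)) = set_pmf p \<inter> cyl (Suc k) y"
      using ext[of x] ext[of y] y by auto
    note lip[unfolded general_lipschitz_def Let_def, THEN conjunct2, rule_format,
      OF calculation(1) conjI[OF calculation(2,3)], unfolded ext_x ext_y]
    then show ?thesis
      using that by blast
  qed
  have "map_pmf \<rho> (prefix_pmf p (Suc k) x) = prefix_pmf p (Suc k) y"
  proof (rule pmf_eq_if_pmf_le)
    fix v
    show "pmf (map_pmf \<rho> (prefix_pmf p (Suc k) x)) v \<le> pmf (prefix_pmf p (Suc k) y) v"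
    proof (cases "v \<in> \<rho> ` set_pmf (prefix_pmf p (Suc k) x)")
      case True
      then obtain w where w: "w \<in> set_pmf p \<inter> cyl (Suc k) x" "v = \<rho> w"
        using x by auto
      then have \<rho>w: "\<rho> w \<in> set_pmf p \<inter> cyl (Suc k) y"
        using \<rho> by blast
      have "y \<in> set_pmf p"
        using y by simp
      with le[OF w(1)] have "pmf (prefix_pmf p (Suc k) x) w \<le> pmf (prefix_pmf p (Suc k) y) (\<rho> w)"
        unfolding cond[OF x w(1)] by (subst (asm) cond[OF _ \<rho>w])
      then show ?thesis
        using w x \<rho>(2) by (simp add: pmf_map_inj)
    next
      case False
      then show ?thesis
        by (simp add: pmf_map_outside)
    qed
  qed
  with b show "\<exists>\<rho>. map_pmf \<rho> (prefix_pmf p (Suc k) x) = prefix_pmf p (Suc k) y \<and>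
          (\<forall>w\<in>set_pmf p \<inter> cyl (Suc k) x.
             \<bar>f w - f (\<rho> w)\<bar> \<le> (if w \<in> \<Gamma> then c (Suc k) else d (Suc k)))"
    by blast
qed


section \<open>Both bounds on the original probability space\<close>

theorem theorem15:
  fixes M :: "'w measure" and N :: nat and \<Lambda> :: "nat \<Rightarrow> 'a set"
    and X :: "nat \<Rightarrow> 'w \<Rightarrow> 'a" and \<Gamma> :: "(nat \<Rightarrow> 'a) set" and \<gamma> :: "nat \<Rightarrow> real"
  assumes "prob_space M"
    and "1 \<le> N"
    and "discrete_family M N \<Lambda> X"
    and "\<Gamma> \<subseteq> PiE {1..N} \<Lambda>"
    and "\<And>k. k \<in> {1..N} \<Longrightarrow> 0 < \<gamma> k \<and> \<gamma> k \<le> 1"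
  shows "\<exists>B \<subseteq> PiE {1..N} \<Lambda>.
    \<P>(\<omega> in M. joint_rv N X \<omega> \<in> B)
      \<le> (\<Sum>k\<in>{1..N}. inverse (\<gamma> k) * \<P>(\<omega> in M. joint_rv N X \<omega> \<notin> \<Gamma>)) \<and>
    PiE {1..N} \<Lambda> - B \<subseteq> \<Gamma> \<and>
    (\<forall>f c d. general_lipschitz M N \<Lambda> X \<Gamma> f c d \<longrightarrow>
      (let \<mu> = prob_space.expectation M (\<lambda>\<omega>. f (joint_rv N X \<omega>));
           e = (\<lambda>k. \<gamma> k * (d k - c k))
       in \<forall>t\<ge>0. \<P>(\<omega> in M. f (joint_rv N X \<omega>) \<ge> \<mu> + t \<and> joint_rv N X \<omega> \<notin> B)
                 \<le> gaussian_tail t (\<Sum>k\<in>{1..N}. (c k + e k)\<^sup>2)))"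
proof -
  interpret prob_space M by fact
  obtain p where p: "measure_pmf p = distr M (count_space UNIV) (joint_rv N X)"
    and J: "joint_rv N X \<in> measurable M (count_space UNIV)"
    and set_p: "set_pmf p \<subseteq> PiE {1..N} \<Lambda>"
    using discrete_family_pmf[OF assms(1,3)] .
  have prob: "\<P>(\<omega> in M. Q (joint_rv N X \<omega>)) = measure_pmf.prob p {x. Q x}" for Q
    unfolding p using J by (subst measure_distr) (auto intro!: arg_cong[where f = "measure M"])
  have prob_cong: "measure_pmf.prob p A = measure_pmf.prob p A'"
    if "\<And>x. x \<in> set_pmf p \<Longrightarrow> x \<in> A \<longleftrightarrow> x \<in> A'" for A A'
    using that by (intro measure_pmf.finite_measure_eq_AE) (auto simp: AE_measure_pmf_iff)
  \<comment> \<open>Points of the product are extensional, so the coordinates in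
    \<open>{1..N}\<close> determine them.\<close>
  have det: "y = x" if "x \<in> set_pmf p" "y \<in> set_pmf p \<inter> cyl N x" for x y
    using that set_p by (intro PiE_ext[of y "{1..N}" \<Lambda> x]) (auto simp: cyl_def)
  \<comment> \<open>Restricting to the product makes \<open>B\<close> an event there and changes no
    probability, as \<open>p\<close> is supported in the product.\<close>
  define B where "B = PiE {1..N} \<Lambda> \<inter> bad_event p N \<Gamma> \<gamma>"
  have in_B: "x \<in> B \<longleftrightarrow> x \<in> bad_event p N \<Gamma> \<gamma>" if "x \<in> set_pmf p" for x
    using that set_p by (auto simp: B_def)
  have "\<P>(\<omega> in M. joint_rv N X \<omega> \<in> B) = measure_pmf.prob p (bad_event p N \<Gamma> \<gamma>)"
    unfolding prob[of "\<lambda>x. x \<in> B"] by (rule prob_cong) (simp add: in_B)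
  also have "\<dots> \<le> (\<Sum>k\<in>{1..N}. inverse (\<gamma> k) * \<P>(\<omega> in M. joint_rv N X \<omega> \<notin> \<Gamma>))"
    using prob_bad_event_le[OF \<open>1 \<le> N\<close>, of \<gamma> p \<Gamma>] assms(5)
    by (simp add: prob[of "\<lambda>x. x \<notin> \<Gamma>"] Compl_eq)
  finally have prob_B: "\<P>(\<omega> in M. joint_rv N X \<omega> \<in> B)
      \<le> (\<Sum>k\<in>{1..N}. inverse (\<gamma> k) * \<P>(\<omega> in M. joint_rv N X \<omega> \<notin> \<Gamma>))" .
  have sub_B: "B \<subseteq> PiE {1..N} \<Lambda>" "PiE {1..N} \<Lambda> - B \<subseteq> \<Gamma>"
    by (auto simp: B_def bad_event_def)
  have tail: "\<P>(\<omega> in M. f (joint_rv N X \<omega>) \<ge> expectation (\<lambda>\<omega>. f (joint_rv N X \<omega>)) + t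
        \<and> joint_rv N X \<omega> \<notin> B)
      \<le> gaussian_tail t (\<Sum>k\<in>{1..N}. (c k + \<gamma> k * (d k - c k))\<^sup>2)"
    if lip: "general_lipschitz M N \<Lambda> X \<Gamma> f c d" and "0 \<le> t" for f c d t
  proof -
    have \<mu>: "expectation (\<lambda>\<omega>. f (joint_rv N X \<omega>)) = measure_pmf.expectation p f"
      unfolding p using J by (simp add: integral_distr)
    moreover have "measure_pmf.prob p {x. f x \<ge> measure_pmf.expectation p f + t \<and> x \<notin> B}
        = measure_pmf.prob p {x. f x \<ge> measure_pmf.expectation p f + t \<and> x \<notin> bad_event p N \<Gamma> \<gamma>}"
      by (rule prob_cong) (simp add: in_B)
    moreover have "c k \<le> d k" if "k \<in> {1..N}" for k
      using lip that by (simp add: general_lipschitz_def)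
    ultimately show ?thesis
      using prob_pmf_tail_le[OF lipschitz_coupling_if_general_lipschitz[OF assms(1) p J set_p lip]
          _ det \<open>0 \<le> t\<close>, of \<gamma>]
      unfolding \<mu> prob[of "\<lambda>x. f x \<ge> measure_pmf.expectation p f + t \<and> x \<notin> B"] by simp
  qed
  show ?thesis
    unfolding Let_def by (rule exI[of _ B]) (intro conjI allI impI sub_B prob_B tail)
qed

end
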